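(* Let $s\in\mathbb N$. Let $I$ be equipped with nested subdivisions whose lengths exhibit a Markovian structure of order $s$ as in the context. Let $X$ be a random variable with values in $J$ and probability density function $f$ which is lower semi-continuous on a Borel set $H\subseteq J$ with $|J\setminus H|=0$, and let $N$, $S$, $R$, $R^{(s)}$ be as in the context. Consider any $n\in\mathbb N_0$ and $(x_1,\dots,x_n)\in\mathcal X^n$ with $\mathrm P(S=(x_1,\dots,x_n))>0$ (that is, $c_{x_1,\dots,x_n}\ell_{x_1,\dots,x_n}>0$). Conditioned on $S=(x_1,\dots,x_n)$, $R^{(s)}$ is a time-homogeneous Markov chain with transition matrix $P$ and initial distribution $$\mathrm P(R_1=x_{n+1},\dots,R_s=x_{n+s}\mid S=(x_1,\dots,x_n))=\begin{cases}\prod_{j=n+1-s}^{n}p_{x_j,\dots,x_{j+s}}&\text{if }n\ge s\\[2pt](\ell_{x_1,\dots,x_s}/\ell_{x_1,\dots,x_n})\prod_{j=1}^{n}p_{x_j,\dots,x_{j+s}}&\text{if }n<s\end{cases}$$ where $\prod_{j=1}^0\cdots$ is interpreted as $1$.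
   Context: Nested subdivisions. $\mathcal X$ is a finite or countable set, $\mathbb N=\{1,2,\dots\}$, $\mathbb N_0=\{0,1,\dots\}$, and $|\cdot|$ is Lebesgue measure. $I=I_\emptyset\subset\mathbb R$ is a Borel set with $\ell_\emptyset=|I|\in(0,\infty)$. For every $n\in\mathbb N$, $I$ is the union of the pairwise disjoint sets $I_{x_1,\dots,x_n}$, $(x_1,\dots,x_n)\in\mathcal X^n$, and $D_n$, where: each $I_k$, $k\in\mathcal X$, is a non-empty open interval; for $n>1$, $I_{x_1,\dots,x_n}$ is an open, possibly empty, interval with $I_{x_1,\dots,x_n}\subseteq I_{x_1,\dots,x_{n-1}}$; $D_n$ is a subset of the endpoints of the non-empty $I_{x_1,\dots,x_n}$'s, and $D_n\subseteq D_{n+1}$. Write $\ell_{x_1,\dots,x_n}=|I_{x_1,\dots,x_n}|$ and assume $\ell_{x_1,\dots,x_n}\to0$ as $n\to\infty$ for every $(x_1,x_2,\dots)\in\mathcal X^{\mathbb N}$. Let $D=\bigcup_nD_n$ (so $|D|=0$) and $J=I\setminus D$. Each $x\in J$ has a unique digit sequence $(x_1,x_2,\dots)\in\mathcal X^{\mathbb N}$ with $x\in I_{x_1,\dots,x_n}$ for all $n\in\mathbb N$, and $x$ is determined by its digits; write $x=.x_1x_2\dots$. If $n=0$, $(x_1,\dots,x_n)$ means the empty sequence $\emptyset$, and $\mathcal X^0=\{\emptyset\}$. Lower semi-continuity. $f$ is regarded as a function on $J$; lower semi-continuity of $f$ on $H$ means $\liminf_m f(y_m)\ge f(x)$ for every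 $x\in H$ and every sequence $y_m\in J$ converging to $x$. The coupling of $X$ and $N$. Let $c_\emptyset=i_\emptyset=\inf_Hf$; for $n\in\mathbb N$, $i_{x_1,\dots,x_n}=\inf_{H\cap I_{x_1,\dots,x_n}}f$ if $H\cap I_{x_1,\dots,x_n}\ne\emptyset$ and $0$ otherwise, and $c_{x_1,\dots,x_n}=i_{x_1,\dots,x_n}-i_{x_1,\dots,x_{n-1}}$. $N$ is an $\mathbb N_0$-valued random variable such that $(X,N)$ has density $f(x,n)=c_{x_1,\dots,x_n}$ for $x=.x_1x_2\dots\in H$, $n\in\mathbb N_0$, with respect to the product of Lebesgue measure on $H$ and counting measure on $\mathbb N_0$. $X=.X_1X_2\dots$ are the digits of $X$; $S=(X_1,\dots,X_N)$ ($=\emptyset$ if $N=0$); $R=(R_1,R_2,\dots)=(X_{N+1},X_{N+2},\dots)$; $R^{(s)}_i=(R_i,\dots,R_{i+s-1})$ for $i\in\mathbb N$, and $R^{(s)}=(R^{(s)}_1,R^{(s)}_2,\dots)$. Markovian structure of order $s$. With the convention $0/0=0$, put $p_{x_1,\dots,x_{s+1}}=\ell_{x_1,\dots,x_{s+1}}/\ell_{x_1,\dots,x_s}$ for $(x_1,\dots,x_{s+1})\in\mathcal X^{s+1}$. The assumption is that for every integer $n\ge s+2$ and every $(x_1,\dots,x_n)\in\mathcal X^n$, $\ell_{x_1,\dots,x_n}=\ell_{x_1,\dots,x_{n-1}}\,p_{x_{n-s},\dots,x_n}$. Let $\Omega=\{(x_1,\dots,x_s)\in\mathcal X^s\mid\ell_{x_1,\dots,x_s}>0\}$,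 and let $P$ be the matrix indexed by $\Omega\times\Omega$ with $P_{(x_1,\dots,x_s),(y_1,\dots,y_s)}=p_{x_1,\dots,x_s,y_s}$ if $y_i=x_{i+1}$ for $1\le i<s$, and $0$ otherwise. *)

theory Defs
  imports "HOL-Probability.Probability" "HOL-Library.Stream"
begin

section \<open>Words and nested subdivisions\<close>

text \<open>Finite digit tuples are lists, infinite digit sequences are streams; the empty tuple is \<open>[]\<close>.\<close>

definition words :: "'d set \<Rightarrow> nat \<Rightarrow> 'd list set" where
  "words A n = {w \<in> lists A. length w = n}"

text \<open>\<open>subword u i j\<close> is \<open>(x_i, ..., x_j)\<close> for \<open>u = (x_1, x_2, ...)\<close>, with positions counted from 1.\<close>

definition subword :: "'d list \<Rightarrow> nat \<Rightarrow> nat \<Rightarrow> 'd list" where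
  "subword u i j = take (Suc j - i) (drop (i - 1) u)"

text \<open>\<open>Iv w\<close> is the set indexed by the word \<open>w\<close>, so \<open>Iv []\<close> is the whole set \<open>I\<close>; the value \<open>D 0\<close>
  is irrelevant. Open intervals may a priori be unbounded, but those below have finite length, and
  the frontier of a non-empty one consists of its two endpoints (that of the empty set is empty).\<close>

locale nested_subdivision =
  fixes A :: "'d set" and Iv :: "'d list \<Rightarrow> real set" and D :: "nat \<Rightarrow> real set"
  assumes countable_alphabet: "countable A"
    and borel_I: "Iv [] \<in> sets borel"
    and length_I: "0 < emeasure lborel (Iv [])" "emeasure lborel (Iv []) < \<infinity>"
    and partition: "\<And>n. n \<ge> 1 \<Longrightarrow> Iv [] = (\<Union>w\<in>words A n. Iv w) \<union> D n"
    and disjoint_intervals: "\<And>n. n \<ge> 1 \<Longrightarrow> disjoint_family_on Iv (words A n)"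
    and disjoint_D: "\<And>n w. n \<ge> 1 \<Longrightarrow> w \<in> words A n \<Longrightarrow> Iv w \<inter> D n = {}"
    and first_nonempty: "\<And>k. k \<in> A \<Longrightarrow> Iv [k] \<noteq> {}"
    and open_interval: "\<And>n w. n \<ge> 1 \<Longrightarrow> w \<in> words A n \<Longrightarrow> open (Iv w) \<and> is_interval (Iv w)"
    and nested: "\<And>n w. n > 1 \<Longrightarrow> w \<in> words A n \<Longrightarrow> Iv w \<subseteq> Iv (butlast w)"
    and D_endpoints: "\<And>n. n \<ge> 1 \<Longrightarrow> D n \<subseteq> (\<Union>w\<in>words A n. frontier (Iv w))"
    and D_mono: "\<And>n. n \<ge> 1 \<Longrightarrow> D n \<subseteq> D (Suc n)"
    and length_tendsto_0:
      "\<And>\<xi>. \<xi> \<in> streams A \<Longrightarrow> (\<lambda>n. measure lborel (Iv (stake n \<xi>))) \<longlonglongrightarrow> 0"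

definition ell :: "('d list \<Rightarrow> real set) \<Rightarrow> 'd list \<Rightarrow> real" where
  "ell Iv w = measure lborel (Iv w)"

definition J_set :: "('d list \<Rightarrow> real set) \<Rightarrow> (nat \<Rightarrow> real set) \<Rightarrow> real set" where
  "J_set Iv D = Iv [] - (\<Union>n\<in>{1..}. D n)"

definition digits :: "'d set \<Rightarrow> ('d list \<Rightarrow> real set) \<Rightarrow> real \<Rightarrow> 'd stream" where
  "digits A Iv x = (THE \<xi>. \<xi> \<in> streams A \<and> (\<forall>n\<ge>1. x \<in> Iv (stake n \<xi>)))"


section \<open>Semi-continuity and the coefficients of the coupling\<close>

definition lsc_on :: "real set \<Rightarrow> real set \<Rightarrow> (real \<Rightarrow> real) \<Rightarrow> bool" where
  "lsc_on J H f \<longleftrightarrow>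
     (\<forall>x\<in>H. \<forall>y. (\<forall>m. y m \<in> J) \<and> y \<longlonglongrightarrow> x \<longrightarrow>
        liminf (\<lambda>m. ereal (f (y m))) \<ge> ereal (f x))"

definition inf_coeff ::
  "('d list \<Rightarrow> real set) \<Rightarrow> real set \<Rightarrow> (real \<Rightarrow> real) \<Rightarrow> 'd list \<Rightarrow> real" where
  "inf_coeff Iv H f w =
     (if w = [] then (INF x\<in>H. f x)
      else if H \<inter> Iv w \<noteq> {} then (INF x\<in>H \<inter> Iv w. f x)
      else 0)"

definition c_coeff ::
  "('d list \<Rightarrow> real set) \<Rightarrow> real set \<Rightarrow> (real \<Rightarrow> real) \<Rightarrow> 'd list \<Rightarrow> real" where
  "c_coeff Iv H f w =
     (if w = [] then inf_coeff Iv H f []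
      else inf_coeff Iv H f w - inf_coeff Iv H f (butlast w))"


section \<open>Markovian structure\<close>

text \<open>The division convention \<open>x / 0 = 0\<close> covers the convention \<open>0 / 0 = 0\<close>. Used only for words of
  length \<open>s + 1\<close>.\<close>

definition p_ratio :: "('d list \<Rightarrow> real set) \<Rightarrow> 'd list \<Rightarrow> real" where
  "p_ratio Iv u = ell Iv u / ell Iv (butlast u)"

definition markovian_lengths :: "'d set \<Rightarrow> ('d list \<Rightarrow> real set) \<Rightarrow> nat \<Rightarrow> bool" where
  "markovian_lengths A Iv s \<longleftrightarrow>
     (\<forall>n\<ge>s + 2. \<forall>u\<in>words A n.
        ell Iv u = ell Iv (butlast u) * p_ratio Iv (subword u (n - s) n))"

definition state_space :: "'d set \<Rightarrow> ('d list \<Rightarrow> real set) \<Rightarrow> nat \<Rightarrow> 'd list set" where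
  "state_space A Iv s = {w \<in> words A s. ell Iv w > 0}"

definition transition_matrix ::
  "('d list \<Rightarrow> real set) \<Rightarrow> nat \<Rightarrow> 'd list \<Rightarrow> 'd list \<Rightarrow> real" where
  "transition_matrix Iv s a b =
     (if \<forall>i. 1 \<le> i \<and> i < s \<longrightarrow> b ! (i - 1) = a ! i then p_ratio Iv (a @ [b ! (s - 1)]) else 0)"

definition homogeneous_markov_chain ::
  "'a measure \<Rightarrow> 'b set \<Rightarrow> ('b \<Rightarrow> 'b \<Rightarrow> real) \<Rightarrow> (nat \<Rightarrow> 'a \<Rightarrow> 'b) \<Rightarrow> bool" where
  "homogeneous_markov_chain M \<Omega> P Y \<longleftrightarrow>
     prob_space M \<and> countable \<Omega> \<and> (\<forall>i. Y i \<in> M \<rightarrow>\<^sub>M count_space \<Omega>) \<and>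
     (\<forall>a\<in>\<Omega>. (\<forall>b\<in>\<Omega>. 0 \<le> P a b) \<and> (P a has_sum 1) \<Omega>) \<and>
     (\<forall>i a b. (\<forall>j\<le>i. a j \<in> \<Omega>) \<and> b \<in> \<Omega> \<and> \<P>(\<omega> in M. \<forall>j\<le>i. Y j \<omega> = a j) > 0 \<longrightarrow>
        \<P>(\<omega> in M. Y (Suc i) \<omega> = b \<bar> \<forall>j\<le>i. Y j \<omega> = a j) = P (a i) b)"

text \<open>\<open>tail_block s R i\<close> is \<open>(R_{i+1}, ..., R_{i+s})\<close>, since \<open>sdrop i\<close> removes the first \<open>i\<close> digits:
  the time of the chain starts at 0 here.\<close>

definition tail_block :: "nat \<Rightarrow> 'd stream \<Rightarrow> nat \<Rightarrow> 'd list" where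
  "tail_block s R i = stake s (sdrop i R)"

text \<open>Here \<open>w = (x_1, ..., x_n)\<close>, \<open>v = (x_{n+1}, ..., x_{n+s})\<close> and \<open>w @ v = (x_1, ..., x_{n+s})\<close>.\<close>

definition initial_distribution ::
  "('d list \<Rightarrow> real set) \<Rightarrow> nat \<Rightarrow> 'd list \<Rightarrow> 'd list \<Rightarrow> real" where
  "initial_distribution Iv s w v =
     (let n = length w; u = w @ v in
      if n \<ge> s then \<Prod>j=n+1-s..n. p_ratio Iv (subword u j (j + s))
      else (ell Iv (subword u 1 s) / ell Iv w) * (\<Prod>j=1..n. p_ratio Iv (subword u j (j + s))))"

end

theory Submission
  imports Defs
begin

text \<open>
  On \<open>{N = n}\<close> the density of the coupling at \<open>x\<close> depends only on the first \<open>n\<close> digits of \<open>x\<close>, so the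
  event that \<open>S = w\<close> and the tail digits start with \<open>v\<close> has probability \<open>c\<^sub>w\<close> times the length of the
  interval of \<open>w @ v\<close>. Conditionally on \<open>S = w\<close> the tail therefore starts with \<open>v\<close> with probability
  \<open>ell (w @ v) / ell w\<close>, and the Markov property and the initial distribution are read off the
  recursion for the lengths. The matrix is stochastic because the intervals of the one-letter
  extensions of a word cover the interval of that word up to a null set.
\<close>

section \<open>Sums, words and blocks of digit streams\<close>

text \<open>Countable additivity of Lebesgue measure yields a sum in the form of a counting-measure
  integral; nonnegativity makes it absolutely summable, which carries it over to
  \<open>has_sum\<close>.\<close>

lemma has_sum_of_nn_integral_count_space:
  fixes f :: "'b \<Rightarrow> real"
  assumes "(\<integral>\<^sup>+x. ennreal (f x) \<partial>count_space B) = ennreal r"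
    and "\<And>x. x \<in> B \<Longrightarrow> 0 \<le> f x" and "0 \<le> r"
  shows "(f has_sum r) B"
proof -
  have *: "has_bochner_integral (count_space B) f r"
    by (rule has_bochner_integral_nn_integral) (use assms in \<open>auto simp: AE_count_space\<close>)
  then have "Infinite_Set_Sum.abs_summable_on f B"
    by (simp add: Infinite_Set_Sum.abs_summable_on_def has_bochner_integral_iff)
  then have "f summable_on B" "infsetsum f B = infsum f B"
    using summable_on_iff_abs_summable_on_real abs_summable_equivalent infsetsum_infsum by blast+
  moreover have "infsetsum f B = r"
    using * by (simp add: infsetsum_def has_bochner_integral_iff)
  ultimately show ?thesis
    by (metis has_sum_infsum)
qed

lemma stake_eq_iff: "stake n \<xi> = stake n \<zeta> \<longleftrightarrow> (\<forall>k<n. \<xi> !! k = \<zeta> !! k)"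
  by (auto simp: list_eq_iff_nth_eq)

lemma take_in_lists: "w \<in> lists A \<Longrightarrow> take k w \<in> lists A"
  by (auto dest: in_set_takeD)

lemma countable_words: "countable A \<Longrightarrow> countable (words A n)"
  by (rule countable_subset[of _ "lists A"]) (auto simp: words_def)

lemma stake_in_lists: "\<xi> \<in> streams A \<Longrightarrow> stake n \<xi> \<in> lists A"
  by (auto simp: in_set_conv_nth snth_in)

lemma stake_in_words: "\<xi> \<in> streams A \<Longrightarrow> stake n \<xi> \<in> words A n"
  using stake_in_lists by (auto simp: words_def)

text \<open>Position \<open>k \<le> i\<close> is the head of block \<open>k\<close>, which exists as
  \<open>s \<ge> 1\<close>, and the later positions lie in block \<open>i\<close>. The history of
  the chain thus becomes a single prefix event.\<close>

lemma all_tail_block_eq_iff: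
  assumes "s \<ge> 1"
  shows "(\<forall>j\<le>i. tail_block s \<xi> j = tail_block s \<zeta> j) \<longleftrightarrow> stake (i + s) \<xi> = stake (i + s) \<zeta>"
    (is "?L \<longleftrightarrow> ?R")
proof
  assume L: ?L
  have "\<xi> !! k = \<zeta> !! k" if "k < i + s" for k
  proof (cases "k \<le> i")
    case True
    then have "tail_block s \<xi> k = tail_block s \<zeta> k" using L by auto
    then have "sdrop k \<xi> !! 0 = sdrop k \<zeta> !! 0"
      unfolding tail_block_def stake_eq_iff using assms by auto
    then show ?thesis by (simp add: sdrop_snth)
  next
    case False
    have "tail_block s \<xi> i = tail_block s \<zeta> i" using L by auto
    then have "sdrop i \<xi> !! (k - i) = sdrop i \<zeta> !! (k - i)"
      unfolding tail_block_def stake_eq_iff using that False by auto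
    then show ?thesis using False by (simp add: sdrop_snth)
  qed
  then show ?R by (simp add: stake_eq_iff)
qed (auto simp: tail_block_def stake_eq_iff sdrop_snth)

lemma tail_block_Suc:
  assumes "s \<ge> 1"
  shows "tail_block s \<xi> (Suc i) = tl (tail_block s \<xi> i) @ [\<xi> !! (i + s)]"
proof -
  obtain t where t: "s = Suc t" using assms by (cases s) auto
  have "stake t (sdrop (Suc i) \<xi>) = tl (stake s (sdrop i \<xi>))"
    by (simp add: t)
  moreover have "sdrop (Suc i) \<xi> !! t = \<xi> !! (i + s)"
    by (simp only: sdrop_snth t add_Suc add_Suc_right)
  ultimately show ?thesis
    unfolding tail_block_def by (metis t stake_Suc)
qed

text \<open>In list form the shift condition of the matrix can be compared directly with
  \<open>tail_block_Suc\<close>.\<close>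

lemma transition_matrix_eq:
  assumes "s \<ge> 1" "length a = s" "length b = s"
  shows "transition_matrix Iv s a b = (if butlast b = tl a then p_ratio Iv (a @ [last b]) else 0)"
proof -
  have "(\<forall>i. 1 \<le> i \<and> i < s \<longrightarrow> b ! (i - 1) = a ! i) \<longleftrightarrow> (\<forall>i. Suc i < s \<longrightarrow> b ! i = a ! Suc i)"
    by (auto simp: gr0_conv_Suc Suc_le_eq)
  also have "\<dots> \<longleftrightarrow> butlast b = tl a"
    using assms by (auto simp: list_eq_iff_nth_eq nth_butlast nth_tl less_diff_conv)
  finally show ?thesis
    using assms last_conv_nth[of b] unfolding transition_matrix_def by (cases "b = []") auto
qed

lemma markovian_lengths_snoc:
  assumes "markovian_lengths A Iv s" "u @ [y] \<in> lists A" "length u \<ge> Suc s"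
  shows "ell Iv (u @ [y]) = ell Iv u * p_ratio Iv (drop (length u - s) u @ [y])"
proof -
  have "u @ [y] \<in> words A (Suc (length u))" using assms(2) by (simp add: words_def)
  then have "ell Iv (u @ [y]) = ell Iv (butlast (u @ [y])) *
      p_ratio Iv (subword (u @ [y]) (Suc (length u) - s) (Suc (length u)))"
    using assms(1,3) unfolding markovian_lengths_def by (metis Suc_le_mono add_2_eq_Suc')
  moreover have "subword (u @ [y]) (Suc (length u) - s) (Suc (length u))
      = drop (length u - s) u @ [y]"
    using assms(3) by (simp add: subword_def)
  ultimately show ?thesis by simp
qed

section \<open>Measures of the intervals and of the exceptional set\<close>

context nested_subdivision
begin

lemma Iv_subset_Nil: "w \<in> lists A \<Longrightarrow> Iv w \<subseteq> Iv []"
proof (cases "w = []")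
  case False
  assume "w \<in> lists A"
  then have "w \<in> words A (length w)" by (simp add: words_def)
  then show ?thesis using partition[of "length w"] False by (cases w) auto
qed auto

lemma Iv_butlast: "w \<in> lists A \<Longrightarrow> Iv w \<subseteq> Iv (butlast w)"
proof (cases "length w > 1")
  case True
  assume "w \<in> lists A"
  then show ?thesis using nested[of "length w" w] True by (auto simp: words_def)
next
  case False
  assume w: "w \<in> lists A"
  have "butlast w = []" using False by (cases w) auto
  then show ?thesis using Iv_subset_Nil[OF w] by simp
qed

lemma Iv_append: "w @ v \<in> lists A \<Longrightarrow> Iv (w @ v) \<subseteq> Iv w"
proof (induction v rule: rev_induct)
  case (snoc y v)
  then show ?case
    using Iv_butlast[of "w @ v @ [y]"] by (auto simp: butlast_append)
qed auto

lemma Iv_take: "w \<in> lists A \<Longrightarrow> Iv w \<subseteq> Iv (take k w)"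
  using Iv_append[of "take k w" "drop k w"] by simp

lemma Iv_open: "w \<in> lists A \<Longrightarrow> w \<noteq> [] \<Longrightarrow> open (Iv w) \<and> is_interval (Iv w)"
  using open_interval[of "length w" w] by (cases w) (auto simp: words_def)

lemma Iv_borel: "w \<in> lists A \<Longrightarrow> Iv w \<in> sets borel"
  using Iv_open[of w] borel_I by (cases "w = []") auto

lemma emeasure_Iv: "w \<in> lists A \<Longrightarrow> emeasure lborel (Iv w) = ennreal (ell Iv w)"
proof -
  assume w: "w \<in> lists A"
  have "emeasure lborel (Iv w) \<le> emeasure lborel (Iv [])"
    using Iv_subset_Nil[OF w] borel_I by (intro emeasure_mono) auto
  then have "emeasure lborel (Iv w) < \<infinity>" using length_I(2) by (simp add: le_less_trans)
  then show ?thesis unfolding ell_def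
    by (intro emeasure_eq_ennreal_measure) auto
qed

lemma ell_nonneg [simp]: "0 \<le> ell Iv w"
  by (simp add: ell_def)

lemma ell_antimono: "w @ v \<in> lists A \<Longrightarrow> ell Iv (w @ v) \<le> ell Iv w"
proof -
  assume "w @ v \<in> lists A"
  then have "emeasure lborel (Iv (w @ v)) \<le> emeasure lborel (Iv w)"
    using Iv_append[of w v] Iv_borel[of w] by (intro emeasure_mono) auto
  then show ?thesis using \<open>w @ v \<in> lists A\<close> emeasure_Iv[of w] emeasure_Iv[of "w @ v"]
    by (simp add: ennreal_le_iff)
qed

text \<open>A non-empty open set is not Lebesgue null; for the empty word, where
  \<open>Iv []\<close> is only Borel, positivity is an assumption.\<close>

lemma ell_pos: "w \<in> lists A \<Longrightarrow> x \<in> Iv w \<Longrightarrow> 0 < ell Iv w"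
proof (cases "w = []")
  case True
  then show ?thesis using length_I emeasure_Iv[of "[]"] by (simp add: ennreal_less_zero_iff)
next
  case False
  assume w: "w \<in> lists A" "x \<in> Iv w"
  then have "\<not> negligible (Iv w)" using Iv_open False open_not_negligible by blast
  then have "emeasure lborel (Iv w) \<noteq> 0"
    using w by (auto simp: negligible_iff_null_sets null_sets_completion_iff Iv_borel null_sets_def)
  then show ?thesis using emeasure_Iv[OF w(1)] ell_nonneg[of w] by (metis ennreal_0 less_eq_real_def)
qed

lemma Iv_disjoint:
  assumes "u \<in> lists A" "v \<in> lists A" "length u = length v" "x \<in> Iv u" "x \<in> Iv v"
  shows "u = v"
proof (cases "u = []")
  case False
  then have "length u \<ge> 1" by (cases u) auto
  then show ?thesis using disjoint_intervals[of "length u"] assms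
    by (auto simp: words_def disjoint_family_on_def)
qed (use assms in auto)

text \<open>The frontier of a convex set is negligible and there are countably many words.
  Negligibility refers to the completed measure, so Borel measurability is shown separately, from
  the partition of \<open>Iv []\<close>.\<close>

lemma D_null: "n \<ge> 1 \<Longrightarrow> D n \<in> null_sets lborel"
proof -
  assume n: "n \<ge> 1"
  have "D n = Iv [] - (\<Union>w\<in>words A n. Iv w)"
    using partition[OF n] disjoint_D[OF n] by auto
  also have "\<dots> \<in> sets borel"
    using borel_I Iv_borel countable_words[OF countable_alphabet]
    by (intro sets.Diff sets.countable_UN') (auto simp: words_def)
  finally have borel: "D n \<in> sets lborel" by simp
  have "negligible (\<Union>w\<in>words A n. frontier (Iv w))"
    using open_interval[OF n] countable_words[OF countable_alphabet]
    by (intro negligible_countable_Union)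
       (auto simp: is_interval_convex_1 intro!: negligible_convex_frontier)
  then have "negligible (D n)" using D_endpoints[OF n] negligible_subset by blast
  then show ?thesis
    using borel by (simp add: negligible_iff_null_sets null_sets_completion_iff)
qed

lemma D_Union_null: "(\<Union>n\<in>{1..}. D n) \<in> null_sets lborel"
  using D_null by (intro null_sets_UN') auto

lemma J_borel: "J_set Iv D \<in> sets borel"
  using D_Union_null borel_I by (auto simp: J_set_def null_sets_def)

text \<open>\<open>Iv u \<inter> H\<close> arises from \<open>Iv u\<close> by removing two null
  sets, the union of the \<open>D n\<close> and \<open>J_set Iv D - H\<close>.\<close>

lemma emeasure_Iv_Int:
  assumes "u \<in> lists A" "H \<in> sets borel" "H \<subseteq> J_set Iv D" "emeasure lborel (J_set Iv D - H) = 0"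
  shows "emeasure lborel (Iv u \<inter> H) = ennreal (ell Iv u)"
proof -
  have "J_set Iv D - H \<in> null_sets lborel" using assms J_borel by (auto simp: null_sets_def)
  then have *: "(\<Union>n\<in>{1..}. D n) \<union> (J_set Iv D - H) \<in> null_sets lborel"
    using D_Union_null by auto
  have "Iv u \<inter> H = Iv u - ((\<Union>n\<in>{1..}. D n) \<union> (J_set Iv D - H))"
    using Iv_subset_Nil[OF assms(1)] assms(3) by (auto simp: J_set_def)
  then have "emeasure lborel (Iv u \<inter> H) = emeasure lborel (Iv u)"
    using emeasure_Diff_null_set[OF *] Iv_borel[OF assms(1)] by simp
  then show ?thesis by (simp add: emeasure_Iv assms)
qed

section \<open>Digit expansions\<close>

text \<open>At each level exactly one word has an interval containing \<open>x\<close>. Nesting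
  makes these words prefixes of one another, so they assemble into a stream, which is unique by
  disjointness.\<close>

lemma digits_Iv:
  assumes "x \<in> J_set Iv D"
  shows "digits A Iv x \<in> streams A \<and> (\<forall>n. x \<in> Iv (stake n (digits A Iv x)))"
proof -
  have "\<exists>u. u \<in> words A n \<and> x \<in> Iv u" for n
  proof (cases "n \<ge> 1")
    case True
    then show ?thesis using assms partition[OF True] by (auto simp: J_set_def)
  next
    case False
    then show ?thesis using assms by (intro exI[of _ "[]"]) (auto simp: J_set_def words_def)
  qed
  then obtain u where u: "u n \<in> words A n" "x \<in> Iv (u n)" for n by metis
  have len: "length (u n) = n" and ul: "u n \<in> lists A" for n using u(1)[of n] by (auto simp: words_def)
  have take_u: "take m (u n) = u m" if "m \<le> n" for m n
    using that ul Iv_take[OF ul, of n m] u(2) len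
    by (intro Iv_disjoint[of _ _ x] take_in_lists) auto
  \<comment> \<open>Digit \<open>n\<close>, counted from 0, is read from the word of level
    \<open>n + 1\<close>, the first one long enough to contain it.\<close>
  define \<xi> where "\<xi> = smap (\<lambda>n. u (Suc n) ! n) nats"
  have st: "stake n \<xi> = u n" for n
  proof (rule nth_equalityI)
    fix i assume "i < length (stake n \<xi>)"
    then have i: "i < n" by simp
    have "u (Suc i) ! i = u n ! i"
      using take_u[of "Suc i" n] i by (metis Suc_leI lessI nth_take)
    then show "stake n \<xi> ! i = u n ! i" using i by (simp add: \<xi>_def)
  qed (simp add: len)
  have xi: "\<xi> \<in> streams A \<and> (\<forall>n\<ge>1. x \<in> Iv (stake n \<xi>))"
  proof (intro conjI allI impI)
    have "u (Suc n) ! n \<in> A" for n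
      using ul[of "Suc n"] len[of "Suc n"] nth_mem[of n "u (Suc n)"] by auto
    then show "\<xi> \<in> streams A" by (simp add: streams_iff_snth \<xi>_def)
  qed (simp add: st u)
  have "digits A Iv x = \<xi>"
    unfolding digits_def
  proof (rule the_equality, rule xi)
    fix \<zeta> assume z: "\<zeta> \<in> streams A \<and> (\<forall>n\<ge>1. x \<in> Iv (stake n \<zeta>))"
    have "stake n \<zeta> = stake n \<xi>" if "n \<ge> 1" for n
      using z xi that stake_in_lists by (intro Iv_disjoint[of _ _ x]) auto
    then have "\<zeta> !! k = \<xi> !! k" for k
      by (metis le_add1 lessI plus_1_eq_Suc stake_nth)
    then show "\<zeta> = \<xi>"
      by (metis stream.map_cong0 stream_smap_nats smap_alt)
  qed
  then show ?thesis using xi st u(2) by simp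
qed

text \<open>Turns events about digits into events about \<open>x\<close>, whose probabilities the
  density gives.\<close>

lemma stake_digits_eq_iff:
  assumes "x \<in> J_set Iv D" "u \<in> lists A"
  shows "stake (length u) (digits A Iv x) = u \<longleftrightarrow> x \<in> Iv u"
  using digits_Iv[OF assms(1)] assms(2) stake_in_lists[of "digits A Iv x" A "length u"]
    Iv_disjoint[of "stake (length u) (digits A Iv x)" u x] by (metis length_stake)

section \<open>Additivity and Markov recursion of the lengths\<close>

text \<open>Up to the null set \<open>D (Suc (length u))\<close>, \<open>Iv u\<close> is the
  disjoint union of the intervals of its one-letter extensions.\<close>

lemma ell_has_sum:
  assumes u: "u \<in> lists A"
  shows "((\<lambda>y. ell Iv (u @ [y])) has_sum ell Iv u) A"
proof (rule has_sum_of_nn_integral_count_space)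
  have uy: "u @ [y] \<in> lists A" if "y \<in> A" for y using u that by auto
  let ?n = "Suc (length u)"
  have "emeasure lborel (Iv u) = emeasure lborel (Iv u - D ?n)"
    using emeasure_Diff_null_set[OF D_null, of ?n "Iv u"] Iv_borel[OF u] by simp
  also have "Iv u - D ?n = (\<Union>y\<in>A. Iv (u @ [y]))"
  proof (intro equalityI subsetI)
    fix x assume x: "x \<in> Iv u - D ?n"
    then obtain v where v: "v \<in> words A ?n" "x \<in> Iv v"
      using partition[of ?n] Iv_subset_Nil[OF u] by auto
    then obtain v' y where vy: "v = v' @ [y]" by (cases v rule: rev_cases) (auto simp: words_def)
    \<comment> \<open>By nesting, the interval of the parent \<open>v'\<close> also contains
      \<open>x\<close>, and disjointness at level \<open>length u\<close> identifies
      \<open>v'\<close> with \<open>u\<close>.\<close>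
    have "v' = u"
      using v vy x u Iv_append[of v' "[y]"] by (intro Iv_disjoint[of _ _ x]) (auto simp: words_def)
    then show "x \<in> (\<Union>y\<in>A. Iv (u @ [y]))" using v vy by (auto simp: words_def)
  next
    fix x assume "x \<in> (\<Union>y\<in>A. Iv (u @ [y]))"
    then obtain y where "y \<in> A" "x \<in> Iv (u @ [y])" by auto
    then show "x \<in> Iv u - D ?n"
      using Iv_append[OF uy[of y]] disjoint_D[of ?n "u @ [y]"] uy[of y] by (auto simp: words_def)
  qed
  also have "emeasure lborel (\<Union>y\<in>A. Iv (u @ [y])) = (\<integral>\<^sup>+y. emeasure lborel (Iv (u @ [y])) \<partial>count_space A)"
  proof (rule emeasure_UN_countable)
    show "disjoint_family_on (\<lambda>y. Iv (u @ [y])) A"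
      unfolding disjoint_family_on_def using Iv_disjoint[OF uy uy] by fastforce
  qed (use uy Iv_borel countable_alphabet in auto)
  also have "\<dots> = (\<integral>\<^sup>+y. ennreal (ell Iv (u @ [y])) \<partial>count_space A)"
    using uy by (intro nn_integral_cong) (auto simp: emeasure_Iv)
  finally show "\<dots> = ennreal (ell Iv u)" by (simp add: emeasure_Iv u)
qed auto

lemma ell_pos_imp_child:
  assumes "u \<in> lists A" "0 < ell Iv u"
  obtains y where "y \<in> A" "0 < ell Iv (u @ [y])"
proof -
  have "\<exists>y\<in>A. ell Iv (u @ [y]) \<noteq> 0"
  proof (rule ccontr)
    assume "\<not> ?thesis"
    then have "((\<lambda>y. ell Iv (u @ [y])) has_sum 0) A" by (intro has_sum_0) auto
    then show False using ell_has_sum[OF assms(1)] assms(2) has_sum_unique by fastforce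
  qed
  then show ?thesis using that ell_nonneg by (metis less_eq_real_def)
qed

text \<open>Extends the recursion to \<open>length u = s\<close>, where the suffix is
  \<open>u\<close> itself and the formula is the definition of \<open>p_ratio\<close>; if
  \<open>ell Iv u = 0\<close>, both sides vanish by monotonicity.\<close>

lemma ell_snoc:
  assumes "markovian_lengths A Iv s" "u @ [y] \<in> lists A" "length u \<ge> s"
  shows "ell Iv (u @ [y]) = ell Iv u * p_ratio Iv (drop (length u - s) u @ [y])"
proof (cases "length u = s")
  case True
  then show ?thesis
    using ell_antimono[OF assms(2)] ell_nonneg[of "u @ [y]"]
    by (cases "ell Iv u = 0") (auto simp: p_ratio_def simp del: ell_nonneg)
qed (use assms markovian_lengths_snoc in force)

text \<open>Some one-letter extension of \<open>u\<close> has positive length, so its factor \<open>p_ratio\<close> is non-zero; by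
  the convention \<open>x / 0 = 0\<close> this forces the denominator, the length of the suffix, to be non-zero.\<close>

lemma ell_suffix_pos:
  assumes "markovian_lengths A Iv s" "u \<in> lists A" "length u \<ge> s" "0 < ell Iv u"
  shows "0 < ell Iv (drop (length u - s) u)"
proof -
  obtain y where y: "y \<in> A" "0 < ell Iv (u @ [y])" using ell_pos_imp_child assms by blast
  then have "p_ratio Iv (drop (length u - s) u @ [y]) \<noteq> 0"
    using ell_snoc[of s u y] assms by auto
  then have "ell Iv (drop (length u - s) u) \<noteq> 0" by (auto simp: p_ratio_def)
  then show ?thesis using ell_nonneg by (metis less_eq_real_def)
qed

text \<open>Iteration of \<open>ell_snoc\<close> from length \<open>k\<close> to length
  \<open>m\<close>: letter number \<open>i\<close>, for \<open>k < i \<le> m\<close>, contributes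
  the factor with \<open>j = i - s\<close>, whose word ends at position \<open>i\<close>.\<close>

lemma ell_take_eq_prod:
  assumes "markovian_lengths A Iv s" "u \<in> lists A" "s \<le> k" "k \<le> m" "m \<le> length u"
  shows "ell Iv (take m u)
    = ell Iv (take k u) * (\<Prod>j=k+1-s..m-s. p_ratio Iv (subword u j (j + s)))"
  using assms(4,5)
proof (induction m rule: dec_induct)
  case base
  then show ?case using assms(3) by simp
next
  case (step m)
  then have m: "m < length u" "s \<le> m" using assms(3) by auto
  have tk: "take (Suc m) u = take m u @ [u ! m]" using m by (simp add: take_Suc_conv_app_nth)
  have "ell Iv (take (Suc m) u)
      = ell Iv (take m u) * p_ratio Iv (drop (m - s) (take m u) @ [u ! m])"
    unfolding tk using m assms(2) take_in_lists[OF assms(2), of m]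
      nth_mem[of m u] ell_snoc[OF assms(1), of "take m u" "u ! m"] by (auto simp: min_def)
  also have "drop (m - s) (take m u) @ [u ! m] = drop (m - s) (take (Suc m) u)"
    unfolding tk using m by simp
  also have "\<dots> = subword u (Suc m - s) (Suc m - s + s)"
    using m by (simp add: subword_def drop_take Suc_diff_le)
  finally show ?case
    using step m assms(3) by (simp add: Suc_diff_le mult.assoc)
qed

text \<open>The recursion only applies from length \<open>s\<close> on. The product therefore starts
  from length \<open>length w\<close> in the first case and from length \<open>s\<close> in the
  second, which leaves the extra quotient \<open>ell Iv (subword u 1 s) / ell Iv w\<close>.\<close>

lemma initial_distribution_eq:
  assumes "markovian_lengths A Iv s" "w @ v \<in> lists A" "length v = s" "ell Iv w \<noteq> 0"
  shows "initial_distribution Iv s w v = ell Iv (w @ v) / ell Iv w"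
proof (cases "length w \<ge> s")
  case True
  then show ?thesis
    using ell_take_eq_prod[OF assms(1,2), of "length w" "length (w @ v)"] assms(3,4)
    by (simp add: initial_distribution_def Let_def)
next
  case False
  then show ?thesis
    using ell_take_eq_prod[OF assms(1,2), of s "length (w @ v)"] assms(3)
    by (simp add: initial_distribution_def Let_def subword_def)
qed

text \<open>The block consists of the last \<open>s\<close> letters of the prefix of length
  \<open>k + i + s\<close>, whose interval has positive length, so \<open>ell_suffix_pos\<close>
  applies.\<close>

lemma tail_block_in_state_space:
  assumes "markovian_lengths A Iv s" "\<xi> \<in> streams A" "\<And>n. 0 < ell Iv (stake n \<xi>)"
  shows "tail_block s (sdrop k \<xi>) i \<in> state_space A Iv s"
proof -
  have eq: "tail_block s (sdrop k \<xi>) i = drop (k + i) (stake (k + i + s) \<xi>)"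
    by (simp add: tail_block_def drop_stake add.commute)
  have "0 < ell Iv (tail_block s (sdrop k \<xi>) i)"
    unfolding eq using ell_suffix_pos[OF assms(1) stake_in_lists[OF assms(2)], of "k + i + s"] assms(3)
    by simp
  moreover have "tail_block s (sdrop k \<xi>) i \<in> words A s"
    unfolding tail_block_def using assms(2) by (intro stake_in_words) (simp add: streams_iff_snth sdrop_snth)
  ultimately show ?thesis by (simp add: state_space_def)
qed

section \<open>The transition matrix\<close>

lemma transition_matrix_nonneg: "0 \<le> transition_matrix Iv s a b"
  by (simp add: transition_matrix_def p_ratio_def)

text \<open>Row \<open>a\<close> vanishes on states other than the words \<open>tl a @ [y]\<close>,
  where its entries \<open>ell Iv (a @ [y]) / ell Iv a\<close> sum to 1 by
  \<open>ell_has_sum\<close>. Such a word may fail to be a state, so its entry must then be shown to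
  be 0.\<close>

lemma transition_matrix_has_sum:
  assumes "s \<ge> 1" "markovian_lengths A Iv s" and a: "a \<in> state_space A Iv s"
  shows "(transition_matrix Iv s a has_sum 1) (state_space A Iv s)"
proof -
  have al: "a \<in> lists A" "length a = s" "0 < ell Iv a"
    using a by (auto simp: state_space_def words_def)
  let ?h = "\<lambda>y. tl a @ [y]"
  have tm: "transition_matrix Iv s a (?h y) = p_ratio Iv (a @ [y])" for y
    using assms(1) al(2) by (subst transition_matrix_eq) auto
  have "((\<lambda>y. ell Iv (a @ [y]) / ell Iv a) has_sum 1) A"
    using has_sum_cmult_left[OF ell_has_sum[OF al(1)], of "inverse (ell Iv a)"] al(3)
    by (simp add: divide_inverse)
  then have "(transition_matrix Iv s a has_sum 1) (?h ` A)"
    by (subst has_sum_reindex) (auto simp: inj_on_def o_def tm p_ratio_def)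
  also have "?this \<longleftrightarrow> ?thesis"
  proof (rule has_sum_cong_neutral)
    fix b assume b: "b \<in> state_space A Iv s - ?h ` A"
    then have bl: "b \<noteq> []" "b \<in> lists A" "length b = s"
      using assms(1) by (auto simp: state_space_def words_def)
    then have "last b \<in> A" by (metis in_listsD last_in_set)
    then have "butlast b \<noteq> tl a" using b bl(1) by (metis DiffD2 append_butlast_last_id imageI)
    then show "transition_matrix Iv s a b = 0"
      using assms(1) al(2) bl by (simp add: transition_matrix_eq)
  next
    fix b assume "b \<in> ?h ` A - state_space A Iv s"
    then obtain y where y: "y \<in> A" "b = ?h y" "?h y \<notin> state_space A Iv s" by auto
    have "tl a \<in> lists A" using al(1) by (cases a) auto
    then have "ell Iv (?h y) \<le> 0"
      using y al(2) assms(1) by (simp add: state_space_def words_def not_less)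
    \<comment> \<open>\<open>?h y\<close> is the suffix of length \<open>s\<close> of
      \<open>a @ [y]\<close>. Since its interval has length zero, \<open>ell_suffix_pos\<close>
      forces the same for the longer word.\<close>
    moreover have "drop 1 (a @ [y]) = ?h y" using al(2) assms(1) by (cases a) auto
    ultimately have "\<not> 0 < ell Iv (a @ [y])"
      using ell_suffix_pos[OF assms(2), of "a @ [y]"] al y(1) by auto
    then have "ell Iv (a @ [y]) = 0" using ell_nonneg[of "a @ [y]"] by linarith
    then show "transition_matrix Iv s a b = 0" by (simp add: y(2) tm p_ratio_def)
  qed auto
  finally show ?thesis .
qed

section \<open>The Markov property\<close>

text \<open>The law of the prefixes of \<open>R\<close> suffices: history and next state are prefix
  events, and the quotient of their probabilities is one factor of the recursion. It is applied to
  the measure conditioned on \<open>S = w\<close>.\<close>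

lemma homogeneous_markov_chain_tail_block:
  assumes s: "s \<ge> 1" and ml: "markovian_lengths A Iv s" and w: "w \<in> lists A"
    and U: "prob_space U"
    and streams: "\<And>\<omega>. \<omega> \<in> space U \<Longrightarrow> R \<omega> \<in> streams A"
    and state: "\<And>\<omega> i. \<omega> \<in> space U \<Longrightarrow> tail_block s (R \<omega>) i \<in> state_space A Iv s"
    and meas: "\<And>v. v \<in> lists A \<Longrightarrow> {\<omega> \<in> space U. stake (length v) (R \<omega>) = v} \<in> sets U"
    and prob: "\<And>v. v \<in> lists A \<Longrightarrow>
      \<P>(\<omega> in U. stake (length v) (R \<omega>) = v) = ell Iv (w @ v) / ell Iv w"
  shows "homogeneous_markov_chain U (state_space A Iv s) (transition_matrix Iv s)
    (\<lambda>i \<omega>. tail_block s (R \<omega>) i)"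
  unfolding homogeneous_markov_chain_def
proof (intro conjI allI ballI impI U)
  show cnt: "countable (state_space A Iv s)"
    by (rule countable_subset[OF _ countable_words[OF countable_alphabet]]) (auto simp: state_space_def)
  fix i
  show "(\<lambda>\<omega>. tail_block s (R \<omega>) i) \<in> U \<rightarrow>\<^sub>M count_space (state_space A Iv s)"
    unfolding measurable_count_space_eq_countable[OF cnt]
  proof (intro conjI ballI)
    fix b assume b: "b \<in> state_space A Iv s"
    then have bl: "b \<in> lists A" "length b = s" by (auto simp: state_space_def words_def)
    \<comment> \<open>Block \<open>i\<close> is in general not a prefix, so the event is split over
      the countably many possibilities for the first \<open>i\<close> digits.\<close>
    have "(\<lambda>\<omega>. tail_block s (R \<omega>) i) -` {b} \<inter> space U
        = (\<Union>v\<in>words A i. {\<omega> \<in> space U. stake (length (v @ b)) (R \<omega>) = v @ b})"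
      (is "?L = ?R")
    proof (intro equalityI subsetI)
      fix \<omega> assume "\<omega> \<in> ?L"
      then have "\<omega> \<in> space U" "stake (i + s) (R \<omega>) = stake i (R \<omega>) @ b"
        by (auto simp: tail_block_def stake_add[symmetric] simp del: stake_add)
      then show "\<omega> \<in> ?R"
        using bl stake_in_words[OF streams, of \<omega> i] by (intro UN_I[of "stake i (R \<omega>)"]) auto
    next
      fix \<omega> assume "\<omega> \<in> ?R"
      then show "\<omega> \<in> ?L"
        using bl by (auto simp: tail_block_def words_def stake_add[symmetric] simp del: stake_add)
    qed
    also have "\<dots> \<in> sets U"
    proof (intro sets.countable_UN' countable_words countable_alphabet image_subsetI)
      fix v assume "v \<in> words A i"
      then show "{\<omega> \<in> space U. stake (length (v @ b)) (R \<omega>) = v @ b} \<in> sets U"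
        using bl by (intro meas) (simp add: words_def)
    qed
    finally show "(\<lambda>\<omega>. tail_block s (R \<omega>) i) -` {b} \<inter> space U \<in> sets U" .
  qed (use state in auto)
next
  fix a b
  show "0 \<le> transition_matrix Iv s a b" by (rule transition_matrix_nonneg)
next
  fix a assume "a \<in> state_space A Iv s"
  then show "(transition_matrix Iv s a has_sum 1) (state_space A Iv s)"
    using transition_matrix_has_sum s ml by blast
next
  fix i a b
  assume H: "(\<forall>j\<le>i. a j \<in> state_space A Iv s) \<and> b \<in> state_space A Iv s \<and>
    0 < \<P>(\<omega> in U. \<forall>j\<le>i. tail_block s (R \<omega>) j = a j)"
  then have "{\<omega> \<in> space U. \<forall>j\<le>i. tail_block s (R \<omega>) j = a j} \<noteq> {}"
    by (metis less_irrefl measure_empty)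
  \<comment> \<open>An outcome realising the history; its prefix \<open>u\<close> of length
    \<open>i + s\<close> glues the overlapping blocks \<open>a 0, ..., a i\<close> into one
    word.\<close>
  then obtain \<omega>0 where \<omega>0: "\<omega>0 \<in> space U" "\<forall>j\<le>i. tail_block s (R \<omega>0) j = a j" by auto
  define u where "u = stake (i + s) (R \<omega>0)"
  have ul: "u \<in> lists A" "length u = i + s"
    using stake_in_lists[OF streams[OF \<omega>0(1)], of "i + s"] by (auto simp: u_def)
  have ai: "a i = drop i u" using \<omega>0 by (auto simp: u_def drop_stake tail_block_def)
  have bl: "b \<noteq> []" "b \<in> lists A" "length b = s"
    using H s by (auto simp: state_space_def words_def)
  then have lb: "last b \<in> A" by (metis in_listsD last_in_set)
  have past: "(\<forall>j\<le>i. tail_block s (R \<omega>) j = a j) \<longleftrightarrow> stake (length u) (R \<omega>) = u" for \<omega>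
    unfolding ul(2) using all_tail_block_eq_iff[OF s, of i "R \<omega>" "R \<omega>0"] \<omega>0(2) by (simp add: u_def)
  have pos: "0 < ell Iv (w @ u) / ell Iv w"
    using H unfolding past prob[OF ul(1)] by simp
  \<comment> \<open>Given the history, only the last letter of the next block is new; the rest is
    forced to be \<open>tl (a i)\<close>.\<close>
  have next_state: "tail_block s (R \<omega>) (Suc i) = b \<and> stake (length u) (R \<omega>) = u \<longleftrightarrow>
      butlast b = tl (a i) \<and> stake (length (u @ [last b])) (R \<omega>) = u @ [last b]" for \<omega>
  proof (cases "stake (length u) (R \<omega>) = u")
    case True
    then have "tail_block s (R \<omega>) i = a i" using past by auto
    then have "tail_block s (R \<omega>) (Suc i) = tl (a i) @ [R \<omega> !! (i + s)]"
      using tail_block_Suc[OF s] by metis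
    moreover have "tl (a i) @ [R \<omega> !! (i + s)] = b \<longleftrightarrow> butlast b = tl (a i) \<and> R \<omega> !! (i + s) = last b"
      using bl(1) by (metis append_butlast_last_id butlast_snoc last_snoc)
    ultimately show ?thesis using True ul(2) by (simp add: stake_Suc del: stake.simps)
  qed (simp add: stake_Suc del: stake.simps)
  show "\<P>(\<omega> in U. tail_block s (R \<omega>) (Suc i) = b \<bar> \<forall>j\<le>i. tail_block s (R \<omega>) j = a j)
      = transition_matrix Iv s (a i) b"
  proof (cases "butlast b = tl (a i)")
    case True
    \<comment> \<open>The conditional probability is
      \<open>ell Iv (w @ u @ [last b]) / ell Iv (w @ u)\<close>. Since
      \<open>length u \<ge> s\<close>, the suffix in the recursion lies within \<open>u\<close> and
      equals \<open>a i\<close>, with no trace of \<open>w\<close>.\<close>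
    have "ell Iv ((w @ u) @ [last b])
        = ell Iv (w @ u) * p_ratio Iv (drop (length (w @ u) - s) (w @ u) @ [last b])"
      using ul w lb by (intro ell_snoc ml) auto
    also have "drop (length (w @ u) - s) (w @ u) = a i" using ul(2) by (simp add: ai)
    finally show ?thesis
      unfolding cond_prob_def past next_state
      using True pos ul lb bl(3) ai prob[OF ul(1)] prob[of "u @ [last b]"]
      by (cases "ell Iv (w @ u) = 0"; cases "ell Iv w = 0")
         (simp_all add: transition_matrix_eq[OF s] del: stake.simps)
  next
    case False
    \<comment> \<open>An incompatible \<open>b\<close> gives an empty joint event and a zero matrix
      entry.\<close>
    then show ?thesis
      unfolding cond_prob_def past next_state using ul bl(3) ai
      by (simp add: transition_matrix_eq[OF s])
  qed
qed

end

section \<open>The joint law of \<open>S\<close> and the tail digits under the coupling\<close>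

theorem theorem4p1:
  fixes A :: "'d set" and Iv :: "'d list \<Rightarrow> real set" and D :: "nat \<Rightarrow> real set"
    and M :: "'a measure" and X :: "'a \<Rightarrow> real" and N :: "'a \<Rightarrow> nat"
    and S :: "'a \<Rightarrow> 'd list" and R :: "'a \<Rightarrow> 'd stream"
    and f :: "real \<Rightarrow> real" and H J :: "real set"
    and s n :: nat and w :: "'d list"
  assumes "s \<ge> 1"
    and "nested_subdivision A Iv D"
    and "markovian_lengths A Iv s"
    and "J = J_set Iv D"
    and "prob_space M"
    and "\<And>x. x \<in> J \<Longrightarrow> 0 \<le> f x"
    and "distributed M (restrict_space lborel J) X (\<lambda>x. ennreal (f x))"
    and "H \<in> sets borel" and "H \<subseteq> J" and "emeasure lborel (J - H) = 0"
    and "lsc_on J H f"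
    and "distributed M (restrict_space lborel J \<Otimes>\<^sub>M count_space UNIV) (\<lambda>\<omega>. (X \<omega>, N \<omega>))
           (\<lambda>(x, k). ennreal (c_coeff Iv H f (stake k (digits A Iv x))) * indicator H x)"
    and "\<And>\<omega>. S \<omega> = stake (N \<omega>) (digits A Iv (X \<omega>))"
    and "\<And>\<omega>. R \<omega> = sdrop (N \<omega>) (digits A Iv (X \<omega>))"
    and "w \<in> words A n"
    and "\<P>(\<omega> in M. S \<omega> = w) > 0"
  shows "homogeneous_markov_chain
           (uniform_measure M {\<omega> \<in> space M. S \<omega> = w})
           (state_space A Iv s)
           (transition_matrix Iv s)
           (\<lambda>i \<omega>. tail_block s (R \<omega>) i)
       \<and> (\<forall>v\<in>words A s.
            \<P>(\<omega> in M. tail_block s (R \<omega>) 0 = v \<bar> S \<omega> = w) = initial_distribution Iv s w v)"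
proof -
  interpret nested_subdivision A Iv D by fact
  interpret M: prob_space M by fact
  note J = \<open>J = J_set Iv D\<close> and ml = \<open>markovian_lengths A Iv s\<close> and s = \<open>s \<ge> 1\<close>
  note XN = \<open>distributed M (restrict_space lborel J \<Otimes>\<^sub>M count_space UNIV) _ _\<close>
  note S = \<open>\<And>\<omega>. S \<omega> = _ \<omega>\<close> and R = \<open>\<And>\<omega>. R \<omega> = _ \<omega>\<close>
  have w: "w \<in> lists A" using \<open>w \<in> words A n\<close> by (simp add: words_def)
  have J_borel': "J \<in> sets borel" using J_borel J by simp
  have XJ: "X \<omega> \<in> J" if "\<omega> \<in> space M" for \<omega>
    using measurable_space[OF distributed_measurable[OF XN] that]
    by (auto simp: space_pair_measure space_restrict_space)
  have rect: "(Iv u \<inter> J) \<times> {k} \<in> sets (restrict_space lborel J \<Otimes>\<^sub>M count_space UNIV)"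
    if "u \<in> lists A" for u :: "'d list" and k :: nat
    using Iv_borel[OF that] J_borel' by (intro pair_measureI) (auto simp: sets_restrict_space_iff)
  have event: "{\<omega> \<in> space M. S \<omega> = u \<and> stake (length v) (R \<omega>) = v}
      = (\<lambda>\<omega>. (X \<omega>, N \<omega>)) -` ((Iv (u @ v) \<inter> J) \<times> {length u}) \<inter> space M"
    if "u \<in> lists A" "v \<in> lists A" for u v
  proof -
    \<comment> \<open>\<open>S \<omega> = u\<close> fixes \<open>N \<omega>\<close>, since
      \<open>stake k\<close> has length \<open>k\<close>; the digits of \<open>X \<omega>\<close>
      then start with \<open>u\<close> followed by \<open>v\<close>.\<close>
    have "S \<omega> = u \<and> stake (length v) (R \<omega>) = v \<longleftrightarrow> N \<omega> = length u \<and> X \<omega> \<in> Iv (u @ v)"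
      if "\<omega> \<in> space M" for \<omega>
    proof -
      have "X \<omega> \<in> Iv (u @ v) \<longleftrightarrow> stake (length u + length v) (digits A Iv (X \<omega>)) = u @ v"
        using stake_digits_eq_iff[of "X \<omega>" "u @ v"] XJ[OF that] J \<open>u \<in> lists A\<close> \<open>v \<in> lists A\<close> by simp
      also have "\<dots> \<longleftrightarrow> stake (length u) (digits A Iv (X \<omega>)) = u \<and>
          stake (length v) (sdrop (length u) (digits A Iv (X \<omega>))) = v"
        by (simp add: stake_add[symmetric] del: stake_add)
      finally show ?thesis unfolding S R by (metis length_stake)
    qed
    then show ?thesis using XJ by auto
  qed
  have event_sets: "{\<omega> \<in> space M. S \<omega> = u \<and> stake (length v) (R \<omega>) = v} \<in> sets M"
    if "u \<in> lists A" "v \<in> lists A" for u v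
    unfolding event[OF that] using rect[of "u @ v"] that
    by (intro measurable_sets[OF distributed_measurable[OF XN]]) auto
  have emeas: "emeasure M {\<omega> \<in> space M. S \<omega> = w \<and> stake (length v) (R \<omega>) = v}
      = ennreal (c_coeff Iv H f w) * ennreal (ell Iv (w @ v))" if v: "v \<in> lists A" for v
  proof -
    have wv: "w @ v \<in> lists A" using v w by simp
    let ?P = "restrict_space lborel J \<Otimes>\<^sub>M count_space (UNIV :: nat set)"
    let ?B = "(Iv (w @ v) \<inter> H) \<times> {length w}"
    have HJ: "Iv (w @ v) \<inter> H \<subseteq> J" using \<open>H \<subseteq> J\<close> by auto
    have IH: "Iv (w @ v) \<inter> H \<in> sets (restrict_space lborel J)"
      using Iv_borel[OF wv] \<open>H \<in> sets borel\<close> HJ J_borel' by (auto simp: sets_restrict_space_iff)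
    have "emeasure M {\<omega> \<in> space M. S \<omega> = w \<and> stake (length v) (R \<omega>) = v}
      = (\<integral>\<^sup>+z. (case z of (x, k) \<Rightarrow> ennreal (c_coeff Iv H f (stake k (digits A Iv x))) * indicator H x)
           * indicator ((Iv (w @ v) \<inter> J) \<times> {length w}) z \<partial>?P)"
      unfolding event[OF w v] by (rule distributed_emeasure[OF XN rect[OF wv]])
    \<comment> \<open>On \<open>Iv (w @ v) \<inter> J\<close> the first \<open>length w\<close>
      digits are \<open>w\<close>, so the coefficient is constant on the slice, and
      \<open>indicator H\<close> shrinks \<open>J\<close> to \<open>H\<close>.\<close>
    also have "\<dots> = (\<integral>\<^sup>+z. ennreal (c_coeff Iv H f w) * indicator ?B z \<partial>?P)"
    proof (rule nn_integral_cong)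
      fix z
      have "stake (length w) (digits A Iv x) = w" if "x \<in> Iv (w @ v)" "x \<in> J" for x
        using stake_digits_eq_iff[of x w] Iv_append[OF wv] that J w by auto
      then show "(case z of (x, k) \<Rightarrow> ennreal (c_coeff Iv H f (stake k (digits A Iv x))) * indicator H x)
           * indicator ((Iv (w @ v) \<inter> J) \<times> {length w}) z
         = ennreal (c_coeff Iv H f w) * indicator ?B z"
        using \<open>H \<subseteq> J\<close> by (auto split: split_indicator prod.splits)
    qed
    also have "\<dots> = ennreal (c_coeff Iv H f w) * emeasure ?P ?B"
      using IH by (intro nn_integral_cmult_indicator pair_measureI) auto
    also have "emeasure ?P ?B = emeasure (restrict_space lborel J) (Iv (w @ v) \<inter> H)"
      using sigma_finite_measure.emeasure_pair_measure_Times[OF sigma_finite_measure_count_space IH,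
          of "{length w}"] by simp
    also have "\<dots> = ennreal (ell Iv (w @ v))"
      using emeasure_restrict_space[of J lborel] HJ J_borel' emeasure_Iv_Int[OF wv] assms(8-10) J by simp
    finally show ?thesis .
  qed
  \<comment> \<open>\<open>C\<close> is \<open>c_coeff Iv H f w\<close> truncated at 0, as
    \<open>ennreal\<close> does in the density. It is positive because \<open>S = w\<close> has
    positive probability, and it cancels in \<open>cond\<close>.\<close>
  define C where "C = enn2real (ennreal (c_coeff Iv H f w))"
  have prob: "\<P>(\<omega> in M. S \<omega> = w \<and> stake (length v) (R \<omega>) = v) = C * ell Iv (w @ v)"
    if "v \<in> lists A" for v
    using emeas[OF that] by (simp add: measure_def C_def enn2real_mult)
  have prob_S: "\<P>(\<omega> in M. S \<omega> = w) = C * ell Iv w" and E_sets: "{\<omega> \<in> space M. S \<omega> = w} \<in> sets M"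
    using prob[of "[]"] event_sets[OF w, of "[]"] by simp_all
  have pos: "0 < C * ell Iv w" using assms(16) prob_S by simp
  have cond: "\<P>(\<omega> in M. stake (length v) (R \<omega>) = v \<bar> S \<omega> = w) = ell Iv (w @ v) / ell Iv w"
    if "v \<in> lists A" for v
    using prob[OF that] pos unfolding cond_prob_def prob_S by (cases "C = 0") (auto simp: conj_commute)
  let ?U = "uniform_measure M {\<omega> \<in> space M. S \<omega> = w}"
  have nz: "emeasure M {\<omega> \<in> space M. S \<omega> = w} \<noteq> 0" "emeasure M {\<omega> \<in> space M. S \<omega> = w} \<noteq> \<infinity>"
    using pos prob_S by (auto simp: M.emeasure_eq_measure)
  \<comment> \<open>\<open>X\<close> lies in \<open>J\<close> at every outcome, so each prefix of
    its digits has a non-empty interval; the blocks of \<open>R\<close> are therefore states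
    everywhere, not just almost surely.\<close>
  have digits_X: "digits A Iv (X \<omega>) \<in> streams A" "0 < ell Iv (stake k (digits A Iv (X \<omega>)))"
    if "\<omega> \<in> space M" for \<omega> k
    using digits_Iv[of "X \<omega>"] XJ[OF that] J ell_pos[OF stake_in_lists] by auto
  \<comment> \<open>The starting position \<open>N\<close> of the tail varies with the outcome, so
    the event is decomposed over the countably many values of \<open>S\<close>.\<close>
  have R_sets: "{\<omega> \<in> space M. stake (length v) (R \<omega>) = v} \<in> sets M" if v: "v \<in> lists A" for v
  proof -
    have "S \<omega> \<in> lists A" if "\<omega> \<in> space M" for \<omega>
      unfolding S by (rule stake_in_lists[OF digits_X(1)[OF that]])
    then have "{\<omega> \<in> space M. stake (length v) (R \<omega>) = v}
        = (\<Union>u\<in>lists A. {\<omega> \<in> space M. S \<omega> = u \<and> stake (length v) (R \<omega>) = v})" by auto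
    also have "\<dots> \<in> sets M"
      using event_sets v countable_alphabet by (intro sets.countable_UN') auto
    finally show ?thesis .
  qed
  have "homogeneous_markov_chain ?U (state_space A Iv s) (transition_matrix Iv s)
      (\<lambda>i \<omega>. tail_block s (R \<omega>) i)"
  proof (rule homogeneous_markov_chain_tail_block[OF s ml w])
    show "prob_space ?U" by (rule prob_space_uniform_measure[OF nz])
  next
    fix v assume v: "v \<in> lists A"
    have "{\<omega> \<in> space M. S \<omega> = w} \<inter> {\<omega> \<in> space M. stake (length v) (R \<omega>) = v}
        = {\<omega> \<in> space M. stake (length v) (R \<omega>) = v \<and> S \<omega> = w}" by blast
    then show "\<P>(\<omega> in ?U. stake (length v) (R \<omega>) = v) = ell Iv (w @ v) / ell Iv w"
      using measure_uniform_measure[OF nz R_sets[OF v]] cond[OF v] by (simp add: cond_prob_def)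
  next
    fix \<omega> assume "\<omega> \<in> space ?U"
    then have \<omega>: "\<omega> \<in> space M" by simp
    show "R \<omega> \<in> streams A"
      unfolding R using digits_X(1)[OF \<omega>] by (simp add: streams_iff_snth sdrop_snth)
    show "tail_block s (R \<omega>) i \<in> state_space A Iv s" for i
      unfolding R using digits_X[OF \<omega>] by (intro tail_block_in_state_space ml)
  qed (simp add: R_sets)
  moreover have "\<P>(\<omega> in M. tail_block s (R \<omega>) 0 = v \<bar> S \<omega> = w) = initial_distribution Iv s w v"
    if v: "v \<in> words A s" for v
  proof -
    have vl: "v \<in> lists A" "length v = s" using v by (auto simp: words_def)
    have "\<P>(\<omega> in M. tail_block s (R \<omega>) 0 = v \<bar> S \<omega> = w) = ell Iv (w @ v) / ell Iv w"
      using cond[OF vl(1)] vl(2) by (simp add: tail_block_def)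
    also have "\<dots> = initial_distribution Iv s w v"
      by (rule initial_distribution_eq[OF ml, symmetric]) (use vl w pos in auto)
    finally show ?thesis .
  qed
  ultimately show ?thesis by blast
qed

end
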